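(* As formal power series in $u$ with coefficients in $\mathbb{Q}[t]$, $$\sum_{n\ge1}\chi_{\Pi_{\Gamma_{2n}}}(t)\,u^n=\sum_{n\ge1}\frac{(t-1)_n\,(t-1)_{n-1}\,u^n}{\prod_{k=1}^n\bigl(1-k(t-k)u\bigr)},$$ where $(a)_n=a(a-1)\cdots(a-(n-1))$ (and $(a)_0=1$).
   Context: $\Gamma_{2n}$ is the bipartite graph on vertex set $[2n]=\{1,\dots,2n\}$ with edges $\{2i-1,2j\}$ for $1\le i\le j\le n$. For a finite graph $G$ with vertex set $V$, the bond lattice $\Pi_G$ is the set of partitions $\pi$ of $V$ such that the induced subgraph of $G$ on each block is connected, ordered by: $\pi\le\pi'$ iff every block of $\pi$ is contained in a block of $\pi'$. For a finite ranked poset $P$ of length $\ell$ with minimum $\hat0$, Möbius function $\mu_P$ and rank function $\mathrm{rk}$, the characteristic polynomial is $\chi_P(t)=\sum_{x\in P}\mu_P(\hat0,x)t^{\ell-\mathrm{rk}(x)}$. ($\Pi_{\Gamma_{2n}}$ is isomorphic to the intersection lattice of the homogenized Linial arrangement $\{x_i-x_j=y_i : 1\le i<j\le n+1\}$ in $\mathbb{R}^{2n+1}$.) *)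

theory Defs
  imports
    "HOL-Library.Disjoint_Sets"
    "HOL-Computational_Algebra.Polynomial"
    "HOL-Computational_Algebra.Formal_Power_Series"
begin

section \<open>The bond lattice of a graph\<close>

text \<open>A graph is given by its vertex set and its set of edges, which are two-element sets of vertices.\<close>

definition Gamma_verts :: "nat \<Rightarrow> nat set" where
  "Gamma_verts n = {1..2 * n}"

definition Gamma_edges :: "nat \<Rightarrow> nat set set" where
  "Gamma_edges n = {{2 * i - 1, 2 * j} | i j. 1 \<le> i \<and> i \<le> j \<and> j \<le> n}"

definition induced_edges :: "'a set set \<Rightarrow> 'a set \<Rightarrow> 'a set set" where
  "induced_edges E B = {e \<in> E. e \<subseteq> B}"

definition connected_graph :: "'a set \<Rightarrow> 'a set set \<Rightarrow> bool" where
  "connected_graph V E \<longleftrightarrow> V \<noteq> {} \<and> (\<forall>u\<in>V. \<forall>v\<in>V. (u, v) \<in> {(x, y). {x, y} \<in> E}\<^sup>*)"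

definition bond_partitions :: "'a set \<Rightarrow> 'a set set \<Rightarrow> 'a set set set" where
  "bond_partitions V E =
     {\<pi>. partition_on V \<pi> \<and> (\<forall>B\<in>\<pi>. connected_graph B (induced_edges E B))}"

definition bond_lattice :: "'a set \<Rightarrow> 'a set set \<Rightarrow> 'a set set rel" where
  "bond_lattice V E =
     {(\<pi>, \<pi>'). \<pi> \<in> bond_partitions V E \<and> \<pi>' \<in> bond_partitions V E \<and> refines V \<pi> \<pi>'}"

section \<open>Finite posets\<close>

text \<open>A finite poset is a finite relation \<open>r\<close> with \<^prop>\<open>Partial_order r\<close>; its underlying set
  is \<^term>\<open>Field r\<close>.\<close>

definition poset_min :: "'a rel \<Rightarrow> 'a" where
  "poset_min r = (THE b. b \<in> Field r \<and> (\<forall>x\<in>Field r. (b, x) \<in> r))"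

text \<open>The test for a finite poset only serves to make the recursion terminate.\<close>

function mobius :: "'a rel \<Rightarrow> 'a \<Rightarrow> 'a \<Rightarrow> int" where
  "mobius r x y =
     (if finite r \<and> Partial_order r \<and> (x, y) \<in> r
      then if x = y then 1 else - (\<Sum>z | (x, z) \<in> r \<and> (z, y) \<in> r \<and> z \<noteq> y. mobius r x z)
      else 0)"
  by pat_completeness auto
termination
proof (relation "measure (\<lambda>(r, x, y). card (under r y))", goal_cases)
  case (2 r x y z)
  then have "antisym r" "trans r" "(y, y) \<in> r"
    by (auto simp: partial_order_on_def preorder_on_def refl_on_def intro: FieldI2)
  moreover have "finite (under r y)"
    by (rule finite_subset[of _ "Field r"]) (use 2 in \<open>auto simp: under_def finite_Field intro: FieldI1\<close>)
  ultimately have "card (under r z) < card (under r y)"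
    using 2 by (intro psubset_card_mono) (auto simp: under_def dest: transD antisymD)
  then show ?case by simp
qed simp

declare mobius.simps [simp del]

text \<open>The length of a chain is one less than its number of elements.\<close>

definition poset_length :: "'a rel \<Rightarrow> nat" where
  "poset_length r = Max (card ` Chains r) - 1"

text \<open>In a ranked poset the rank of \<open>x\<close> is the length of the interval of all elements below \<open>x\<close>.\<close>

definition poset_rank :: "'a rel \<Rightarrow> 'a \<Rightarrow> nat" where
  "poset_rank r x = poset_length (Restr r (under r x))"

definition poset_char_poly :: "'a rel \<Rightarrow> rat poly" where
  "poset_char_poly r =
     (\<Sum>x\<in>Field r. monom (of_int (mobius r (poset_min r) x)) (poset_length r - poset_rank r x))"

section \<open>Falling factorials and reciprocals of power series\<close>

definition falling_fact :: "'a::comm_ring_1 \<Rightarrow> nat \<Rightarrow> 'a" where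
  "falling_fact a n = (\<Prod>i<n. a - of_nat i)"

text \<open>The polynomial indeterminate.\<close>

abbreviation tvar :: "rat poly" where
  "tvar \<equiv> [:0, 1:]"

text \<open>The coefficient ring of \<^typ>\<open>rat poly fps\<close> is not a field, so \<^const>\<open>inverse\<close> is not available
  on it. A series with constant term \<open>1\<close> still has a unique reciprocal.\<close>

definition fps_recip :: "'a::comm_ring_1 fps \<Rightarrow> 'a fps" where
  "fps_recip f = fps_right_inverse f 1"

lemma fps_recip: "fps_nth f 0 = 1 \<Longrightarrow> f * fps_recip f = 1"
  unfolding fps_recip_def by (rule fps_right_inverse) simp

section \<open>The bond lattice is a finite poset with minimum\<close>

lemma Field_bond_lattice: "Field (bond_lattice V E) = bond_partitions V E"
  by (auto simp: Field_def bond_lattice_def bond_partitions_def intro: refines_refl)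

lemma finite_bond_lattice:
  assumes "finite V"
  shows "finite (bond_lattice V E)"
proof (rule finite_subset)
  show "bond_lattice V E \<subseteq> Pow (Pow V) \<times> Pow (Pow V)"
    by (auto simp: bond_lattice_def bond_partitions_def partition_on_def)
qed (use assms in simp)

lemma Partial_order_bond_lattice: "Partial_order (bond_lattice V E)"
  unfolding partial_order_on_def preorder_on_def Field_bond_lattice
proof (intro conjI)
  show "refl_on (bond_partitions V E) (bond_lattice V E)"
    by (auto simp: refl_on_def bond_lattice_def bond_partitions_def intro: refines_refl)
  show "trans (bond_lattice V E)"
    by (auto simp: trans_def bond_lattice_def intro: refines_trans)
  show "antisym (bond_lattice V E)"
    by (auto simp: antisym_def bond_lattice_def dest: refines_asym)
qed (auto simp: bond_lattice_def)

lemma poset_min_bond_lattice: "poset_min (bond_lattice V E) = (\<lambda>v. {v}) ` V"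
  unfolding poset_min_def Field_bond_lattice
proof (rule the_equality)
  let ?b = "(\<lambda>v. {v}) ` V"
  have "?b \<in> bond_partitions V E"
    by (auto simp: bond_partitions_def partition_on_def disjoint_def connected_graph_def)
  moreover have "(?b, \<pi>) \<in> bond_lattice V E" if "\<pi> \<in> bond_partitions V E" for \<pi>
    using that \<open>?b \<in> _\<close> by (auto simp: bond_lattice_def bond_partitions_def refines_def partition_on_def)
  ultimately show *: "?b \<in> bond_partitions V E \<and> (\<forall>x\<in>bond_partitions V E. (?b, x) \<in> bond_lattice V E)"
    by blast
  show "b = ?b"
    if "b \<in> bond_partitions V E \<and> (\<forall>x\<in>bond_partitions V E. (b, x) \<in> bond_lattice V E)" for b
    using that * by (intro refines_asym[of V]) (auto simp: bond_lattice_def)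
qed

end

theory Submission
  imports Defs
begin

unbundle fps_syntax

text \<open>By Whitney's theorem, \<open>t * \<chi>(t)\<close> is the chromatic polynomial of a connected graph: every colouring is
  constant on the blocks of exactly those bond partitions that lie below the partition into the connected
  components of its colour classes, and summing \<open>\<mu>(0, \<pi>)\<close> over these leaves the proper colourings only.
  Colour the vertices of \<open>\<Gamma>\<^sub>2\<^sub>n\<close> in the order \<open>1, 2, \<dots>, 2n\<close> and let \<open>m\<close> be the number of colours that occur on
  odd vertices. Every even vertex is adjacent to precisely the odd vertices before it, so a new pair
  contributes a factor \<open>m (t - m)\<close> when its odd vertex repeats a colour and \<open>(t - m + 1) (t - m)\<close> when it
  raises the number of colours to \<open>m\<close>. This is the recurrence of the coefficients of the \<open>m\<close>-th summand,
  multiplied by \<open>t\<close>.\<close>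

section \<open>Whitney's theorem for the bond lattice\<close>

text \<open>For \<open>x \<noteq> y\<close> this is the defining recursion with the term at
  \<open>z = y\<close> moved to the other side; for \<open>x = y\<close> antisymmetry leaves a
  single term.\<close>

lemma mobius_sum_below:
  assumes "finite r" "Partial_order r" "(x, y) \<in> r"
  shows "(\<Sum>z | (x, z) \<in> r \<and> (z, y) \<in> r. mobius r x z) = (if x = y then 1 else 0)"
proof -
  have refl: "(x, x) \<in> r" "(y, y) \<in> r" and anti: "antisym r"
    using assms by (auto simp: partial_order_on_def preorder_on_def refl_on_def intro: FieldI1 FieldI2)
  show ?thesis
  proof (cases "x = y")
    case True
    then have "{z. (x, z) \<in> r \<and> (z, y) \<in> r} = {x}"
      using refl anti by (auto dest: antisymD)
    then show ?thesis using True assms refl by (simp add: mobius.simps[of r y y])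
  next
    case False
    let ?A = "{z. (x, z) \<in> r \<and> (z, y) \<in> r}"
    have "finite ?A"
      by (rule finite_subset[of _ "Field r"]) (use assms in \<open>auto simp: finite_Field intro: FieldI1\<close>)
    moreover have "y \<in> ?A" using assms refl by auto
    ultimately have "sum (mobius r x) ?A = mobius r x y + sum (mobius r x) (?A - {y})"
      by (rule sum.remove)
    moreover have "?A - {y} = {z. (x, z) \<in> r \<and> (z, y) \<in> r \<and> z \<noteq> y}" by auto
    ultimately show ?thesis using False assms by (simp add: mobius.simps[of r x y])
  qed
qed

lemma bond_latticeI:
  assumes "\<pi> \<in> bond_partitions V E" "\<pi>' \<in> bond_partitions V E"
    "\<And>B. B \<in> \<pi> \<Longrightarrow> \<exists>B'\<in>\<pi>'. B \<subseteq> B'"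
  shows "(\<pi>, \<pi>') \<in> bond_lattice V E"
  using assms by (auto simp: bond_lattice_def bond_partitions_def refines_def)

lemma singletons_in_bond_partitions: "(\<lambda>v. {v}) ` V \<in> bond_partitions V E"
  by (auto simp: bond_partitions_def partition_on_def disjoint_def connected_graph_def)

lemma finite_bond_partitions: "finite V \<Longrightarrow> finite (bond_partitions V E)"
  by (rule finite_subset[OF _ finitely_many_partition_on]) (auto simp: bond_partitions_def)

lemma singletons_le:
  assumes "\<pi> \<in> bond_partitions V E"
  shows "((\<lambda>v. {v}) ` V, \<pi>) \<in> bond_lattice V E"
  using singletons_in_bond_partitions assms
  by (auto simp: bond_lattice_def bond_partitions_def refines_def partition_on_def)

section \<open>Monochromatic components as the greatest bond partition respecting a
  colouring\<close>

definition constant_on_blocks :: "'a set set \<Rightarrow> ('a \<Rightarrow> 'b) \<Rightarrow> bool" where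
  "constant_on_blocks \<pi> c \<longleftrightarrow> (\<forall>B\<in>\<pi>. \<forall>x\<in>B. \<forall>y\<in>B. c x = c y)"

definition proper_colouring :: "'a set \<Rightarrow> 'a set set \<Rightarrow> ('a \<Rightarrow> 'b) \<Rightarrow> bool" where
  "proper_colouring V E c \<longleftrightarrow> (\<forall>x\<in>V. \<forall>y\<in>V. {x, y} \<in> E \<longrightarrow> c x \<noteq> c y)"

text \<open>Reachability along monochromatic edges is cut down to \<open>u \<in> V\<close>, because
  the reflexive closure relates every element of the type to itself.\<close>

definition mono_components :: "'a set \<Rightarrow> 'a set set \<Rightarrow> ('a \<Rightarrow> 'b) \<Rightarrow> 'a set set" where
  "mono_components V E c =
     V // {(u, v). u \<in> V \<and> (u, v) \<in> {(x, y). x \<in> V \<and> y \<in> V \<and> {x, y} \<in> E \<and> c x = c y}\<^sup>*}"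

context
  fixes V :: "'a set" and E :: "'a set set" and c :: "'a \<Rightarrow> 'b" and M K
  defines "M \<equiv> {(x, y). x \<in> V \<and> y \<in> V \<and> {x, y} \<in> E \<and> c x = c y}"
    and "K \<equiv> {(u, v). u \<in> V \<and> (u, v) \<in> M\<^sup>*}"
begin

lemma mono_components_eq: "mono_components V E c = V // K"
  by (simp add: mono_components_def K_def M_def)

lemma mono_path_in: "(u, v) \<in> M\<^sup>* \<Longrightarrow> u \<in> V \<Longrightarrow> v \<in> V \<and> c u = c v"
  by (induction rule: rtrancl_induct) (auto simp: M_def)

lemma equiv_mono: "equiv V K"
proof (rule equivI)
  have "sym M" by (auto simp: sym_def M_def insert_commute)
  then have "sym (M\<^sup>*)" by (rule sym_rtrancl)
  then show "sym K" using mono_path_in by (auto simp: sym_def K_def)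
  show "refl_on V K" by (auto simp: refl_on_def K_def)
  show "K \<subseteq> V \<times> V" using mono_path_in by (auto simp: K_def)
  show "trans K" by (auto simp: trans_def K_def)
qed

text \<open>A monochromatic path never leaves the class it starts in, so it is also a path of the
  induced subgraph.\<close>

lemma mono_components_in_bond_partitions: "mono_components V E c \<in> bond_partitions V E"
proof -
  have "connected_graph (K `` {x}) (induced_edges E (K `` {x}))" if "x \<in> V" for x
  proof -
    let ?B = "K `` {x}" let ?I = "{(x, y). {x, y} \<in> induced_edges E ?B}"
    \<comment> \<open>Membership in the class is carried through the induction, because an edge
      counts as induced only if both its ends lie in the class.\<close>
    have "v \<in> ?B \<and> (u, v) \<in> ?I\<^sup>*" if "(u, v) \<in> M\<^sup>*" "u \<in> ?B" for u v
      using that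
    proof (induction rule: rtrancl_induct)
      case (step y z)
      then have "(x, y) \<in> M\<^sup>*" "x \<in> V" by (auto simp: K_def)
      with step(2) have "(x, z) \<in> M\<^sup>*" by simp
      then have z: "z \<in> ?B" using \<open>x \<in> V\<close> by (simp add: K_def)
      moreover have "(y, z) \<in> ?I"
        using step z by (auto simp: induced_edges_def M_def)
      ultimately show ?case using step by (auto intro: rtrancl_into_rtrancl)
    qed simp
    moreover have "(u, v) \<in> M\<^sup>*" if "u \<in> ?B" "v \<in> ?B" for u v
    proof -
      have "(u, x) \<in> K" "(x, v) \<in> K"
        using that equiv_mono by (auto dest: equivE symD)
      then show ?thesis by (auto simp: K_def)
    qed
    moreover have "x \<in> ?B" using that by (simp add: K_def)
    ultimately show ?thesis unfolding connected_graph_def by blast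
  qed
  then show ?thesis
    using partition_on_quotient[OF equiv_mono]
    by (auto simp: bond_partitions_def mono_components_eq quotient_def)
qed

text \<open>Inside a block on which \<open>c\<close> is constant every edge is monochromatic, so the
  block, being connected, lies in one class. Conversely, the colour does not change along
  monochromatic edges.\<close>

lemma constant_on_blocks_iff:
  assumes "\<pi> \<in> bond_partitions V E"
  shows "constant_on_blocks \<pi> c \<longleftrightarrow> (\<pi>, mono_components V E c) \<in> bond_lattice V E"
proof
  assume const: "constant_on_blocks \<pi> c"
  show "(\<pi>, mono_components V E c) \<in> bond_lattice V E"
  proof (rule bond_latticeI[OF assms mono_components_in_bond_partitions])
    fix B assume B: "B \<in> \<pi>"
    let ?I = "{(x, y). {x, y} \<in> induced_edges E B}"
    have conn: "connected_graph B (induced_edges E B)" and BV: "B \<subseteq> V"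
      using assms B by (auto simp: bond_partitions_def partition_on_def)
    have "?I \<subseteq> M"
      using const B BV by (auto simp: induced_edges_def M_def constant_on_blocks_def)
    then have "?I\<^sup>* \<subseteq> M\<^sup>*" by (rule rtrancl_mono)
    moreover obtain x where "x \<in> B" using conn by (auto simp: connected_graph_def)
    ultimately have "B \<subseteq> K `` {x}" "x \<in> V"
      using conn BV by (auto simp: connected_graph_def K_def)
    then show "\<exists>B'\<in>mono_components V E c. B \<subseteq> B'"
      by (auto simp: mono_components_eq quotient_def)
  qed
next
  assume "(\<pi>, mono_components V E c) \<in> bond_lattice V E"
  then have *: "\<exists>x\<in>V. B \<subseteq> K `` {x}" if "B \<in> \<pi>" for B
    using that by (force simp: bond_lattice_def refines_def mono_components_eq quotient_def)
  show "constant_on_blocks \<pi> c"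
    unfolding constant_on_blocks_def
  proof (intro ballI)
    fix B x y assume "B \<in> \<pi>" "x \<in> B" "y \<in> B"
    moreover from this obtain z where "z \<in> V" "B \<subseteq> K `` {z}"
      using * by blast
    ultimately have "z \<in> V" "(z, x) \<in> M\<^sup>*" "(z, y) \<in> M\<^sup>*"
      by (auto simp: K_def)
    then show "c x = c y" using mono_path_in by metis
  qed
qed

text \<open>Without monochromatic edges all classes are singletons. A monochromatic edge puts both
  its ends into one class, and these ends differ because there are no loops.\<close>

lemma mono_components_singletons_iff:
  assumes "\<And>x. {x} \<notin> E"
  shows "(\<lambda>v. {v}) ` V = mono_components V E c \<longleftrightarrow> proper_colouring V E c"
proof
  assume eq: "(\<lambda>v. {v}) ` V = mono_components V E c"
  show "proper_colouring V E c"
    unfolding proper_colouring_def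
  proof (intro ballI impI notI)
    fix x y assume xy: "x \<in> V" "y \<in> V" "{x, y} \<in> E" "c x = c y"
    then have "(x, y) \<in> M\<^sup>*" by (auto simp: M_def)
    then have "x \<in> K `` {x}" "y \<in> K `` {x}" using xy by (auto simp: K_def)
    moreover have "K `` {x} \<in> (\<lambda>v. {v}) ` V"
      unfolding eq mono_components_eq using xy by (auto simp: quotient_def)
    then obtain v where "K `` {x} = {v}" by blast
    ultimately have "x \<in> {v}" "y \<in> {v}" by metis+
    then have "x = y" by simp
    then show False using xy assms by auto
  qed
next
  assume "proper_colouring V E c"
  then have "M = {}" by (auto simp: M_def proper_colouring_def)
  then have "K `` {x} = {x}" if "x \<in> V" for x using that by (auto simp: K_def)
  then show "(\<lambda>v. {v}) ` V = mono_components V E c"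
    unfolding mono_components_eq quotient_def by blast
qed

end

section \<open>Double count of bond partitions and colourings\<close>

lemma partition_on_unique_block:
  "partition_on V \<pi> \<Longrightarrow> A \<in> \<pi> \<Longrightarrow> B \<in> \<pi> \<Longrightarrow> x \<in> A \<Longrightarrow> x \<in> B \<Longrightarrow> A = B"
  by (auto simp: partition_on_def disjoint_def)

text \<open>Such a colouring amounts to a free choice of one colour for each block.\<close>

lemma card_constant_on_blocks:
  assumes "finite V" "partition_on V \<pi>"
  shows "card {c \<in> V \<rightarrow>\<^sub>E {..<q}. constant_on_blocks \<pi> c} = q ^ card \<pi>"
proof -
  define blk where "blk v = (THE B. B \<in> \<pi> \<and> v \<in> B)" for v
  have blk_eq: "blk v = B" if "B \<in> \<pi>" "v \<in> B" for v B
    unfolding blk_def using that partition_on_unique_block[OF assms(2)] by (intro the_equality) blast+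
  have VU: "v \<in> V" if "B \<in> \<pi>" "v \<in> B" for B v
    using assms(2) that by (auto simp: partition_on_def)
  have ne: "B \<noteq> {}" if "B \<in> \<pi>" for B
    using assms(2) that by (auto simp: partition_on_def)
  have blk: "blk v \<in> \<pi> \<and> v \<in> blk v" if v: "v \<in> V" for v
  proof -
    obtain B where "B \<in> \<pi>" "v \<in> B"
      using v assms(2) unfolding partition_on_def by blast
    then show ?thesis using blk_eq by simp
  qed
  have "bij_betw (\<lambda>g. \<lambda>v\<in>V. g (blk v)) (\<pi> \<rightarrow>\<^sub>E {..<q}) {c \<in> V \<rightarrow>\<^sub>E {..<q}. constant_on_blocks \<pi> c}"
  proof (rule bij_betwI')
    fix g h assume gh: "g \<in> \<pi> \<rightarrow>\<^sub>E {..<q}" "h \<in> \<pi> \<rightarrow>\<^sub>E {..<q}"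
    show "((\<lambda>v\<in>V. g (blk v)) = (\<lambda>v\<in>V. h (blk v))) = (g = h)"
    proof
      assume eq: "(\<lambda>v\<in>V. g (blk v)) = (\<lambda>v\<in>V. h (blk v))"
      show "g = h"
      proof (rule PiE_ext[OF gh])
        fix B assume B: "B \<in> \<pi>"
        then obtain v where v: "v \<in> B" using ne by blast
        then have "v \<in> V" using B VU by blast
        then show "g B = h B" using fun_cong[OF eq, of v] blk_eq[OF B v] by simp
      qed
    qed simp
  next
    fix g assume g: "g \<in> \<pi> \<rightarrow>\<^sub>E {..<q}"
    have "constant_on_blocks \<pi> (\<lambda>v\<in>V. g (blk v))"
      unfolding constant_on_blocks_def using VU blk_eq by (auto simp: restrict_def)
    then show "(\<lambda>v\<in>V. g (blk v)) \<in> {c \<in> V \<rightarrow>\<^sub>E {..<q}. constant_on_blocks \<pi> c}"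
      using g blk by (auto simp: PiE_iff)
  next
    fix c assume c: "c \<in> {c \<in> V \<rightarrow>\<^sub>E {..<q}. constant_on_blocks \<pi> c}"
    \<comment> \<open>The colour of a block is read off at an arbitrary element, which exists since
      blocks are nonempty.\<close>
    let ?g = "\<lambda>B\<in>\<pi>. c (SOME v. v \<in> B)"
    have some: "(SOME v. v \<in> B) \<in> B" if "B \<in> \<pi>" for B
      using ne[OF that] by (simp add: some_in_eq)
    have "?g \<in> \<pi> \<rightarrow>\<^sub>E {..<q}"
      using c some VU by (auto simp: PiE_iff)
    moreover have "c = (\<lambda>v\<in>V. ?g (blk v))"
    proof
      fix v show "c v = (\<lambda>v\<in>V. ?g (blk v)) v"
      proof (cases "v \<in> V")
        case True
        then show ?thesis
          using c blk[OF True] some[of "blk v"] by (auto simp: constant_on_blocks_def)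
      next
        case False
        then show ?thesis using c by (auto simp: PiE_iff extensional_def)
      qed
    qed
    ultimately show "\<exists>g\<in>\<pi> \<rightarrow>\<^sub>E {..<q}. c = (\<lambda>v\<in>V. g (blk v))" by blast
  qed
  then have "card (\<pi> \<rightarrow>\<^sub>E {..<q}) = card {c \<in> V \<rightarrow>\<^sub>E {..<q}. constant_on_blocks \<pi> c}"
    by (rule bij_betw_same_card)
  then show ?thesis
    using finite_elements[OF assms] by (simp add: card_PiE)
qed

text \<open>Pairs of a bond partition and a colouring constant on its blocks, weighted by the
  Moebius value of the partition, are summed in both orders. A fixed partition admits
  \<open>q ^ card \<pi>\<close> colourings; for a fixed colouring the weights cancel unless it is
  proper.\<close>

lemma card_proper_colourings:
  fixes V :: "'a set"
  assumes "finite V" "\<And>x. {x} \<notin> E"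
  shows "int (card {c \<in> V \<rightarrow>\<^sub>E {..<q}. proper_colouring V E c}) =
    (\<Sum>\<pi>\<in>bond_partitions V E.
       mobius (bond_lattice V E) (poset_min (bond_lattice V E)) \<pi> * int q ^ card \<pi>)"
proof -
  let ?P = "bond_partitions V E" and ?r = "bond_lattice V E" and ?C = "V \<rightarrow>\<^sub>E {..<q}"
  let ?m = "mobius ?r (poset_min ?r)"
  have fin: "finite ?P" "finite ?C"
    using assms by (auto intro: finite_bond_partitions finite_PiE)
  have min: "(poset_min ?r, \<pi>) \<in> ?r" if "\<pi> \<in> ?P" for \<pi>
    using singletons_le[OF that] by (simp only: poset_min_bond_lattice)
  have "(\<Sum>\<pi>\<in>?P. ?m \<pi> * int q ^ card \<pi>) =
        (\<Sum>\<pi>\<in>?P. \<Sum>c\<in>?C. if constant_on_blocks \<pi> c then ?m \<pi> else 0)"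
  proof (rule sum.cong[OF refl])
    fix \<pi> assume "\<pi> \<in> ?P"
    then have "q ^ card \<pi> = card {c \<in> ?C. constant_on_blocks \<pi> c}"
      using assms by (simp add: card_constant_on_blocks bond_partitions_def)
    then have "int q ^ card \<pi> = int (card {c \<in> ?C. constant_on_blocks \<pi> c})"
      by (metis of_nat_power)
    then show "?m \<pi> * int q ^ card \<pi> = (\<Sum>c\<in>?C. if constant_on_blocks \<pi> c then ?m \<pi> else 0)"
      using fin by (simp add: sum.If_cases Int_def)
  qed
  also have "\<dots> = (\<Sum>c\<in>?C. \<Sum>\<pi>\<in>?P. if constant_on_blocks \<pi> c then ?m \<pi> else 0)"
    by (rule sum.swap)
  also have "\<dots> = (\<Sum>c\<in>?C. if proper_colouring V E c then 1 else 0)"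
  proof (rule sum.cong[OF refl])
    fix c assume "c \<in> ?C"
    let ?k = "mono_components V E c"
    have k: "?k \<in> ?P" by (rule mono_components_in_bond_partitions)
    have "(\<Sum>\<pi>\<in>?P. if constant_on_blocks \<pi> c then ?m \<pi> else 0) =
          (\<Sum>\<pi> | \<pi> \<in> ?P \<and> constant_on_blocks \<pi> c. ?m \<pi>)"
      using fin by (simp add: sum.If_cases Int_def)
    \<comment> \<open>The partitions respecting \<open>c\<close> form the interval from the minimum
      to \<open>?k\<close>, over which the Moebius values sum to 0 unless the interval is a
      point.\<close>
    also have "{\<pi>. \<pi> \<in> ?P \<and> constant_on_blocks \<pi> c} =
        {\<pi>. (poset_min ?r, \<pi>) \<in> ?r \<and> (\<pi>, ?k) \<in> ?r}"
      using constant_on_blocks_iff[of _ V E c] min by (auto simp: bond_lattice_def)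
    also have "(\<Sum>\<pi>\<in>\<dots>. ?m \<pi>) = (if poset_min ?r = ?k then 1 else 0)"
      using assms min[OF k]
      by (intro mobius_sum_below finite_bond_lattice Partial_order_bond_lattice) auto
    also have "\<dots> = (if proper_colouring V E c then 1 else 0)"
      using mono_components_singletons_iff[of E V c] assms by (simp add: poset_min_bond_lattice)
    finally show "(\<Sum>\<pi>\<in>?P. if constant_on_blocks \<pi> c then ?m \<pi> else 0) =
      (if proper_colouring V E c then 1 else 0)" .
  qed
  also have "\<dots> = int (card {c \<in> ?C. proper_colouring V E c})"
    using fin by (simp add: sum.If_cases Int_def)
  finally show ?thesis by simp
qed

section \<open>Ranks in the bond lattice\<close>

text \<open>Each block of \<open>\<sigma>\<close> goes to the block of \<open>\<pi>\<close> around
  it; this map is onto because \<open>\<sigma>\<close> covers \<open>V\<close>. With equal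
  cardinalities it is injective too, so every block of \<open>\<pi>\<close> consists of a single
  block of \<open>\<sigma>\<close>.\<close>

lemma bond_lattice_card_le:
  assumes "finite V" "(\<sigma>, \<pi>) \<in> bond_lattice V E"
  shows "card \<pi> \<le> card \<sigma>" and "card \<pi> = card \<sigma> \<Longrightarrow> \<sigma> = \<pi>"
proof -
  have ref: "refines V \<sigma> \<pi>" and part: "partition_on V \<sigma>" "partition_on V \<pi>"
    using assms by (auto simp: bond_lattice_def refines_def)
  obtain f where f: "f A \<in> \<pi>" "A \<subseteq> f A" if "A \<in> \<sigma>" for A
    using ref unfolding refines_def by metis
  have fin: "finite \<sigma>" "finite \<pi>"
    using part assms by (auto intro: finite_elements)
  have cover: "\<exists>A\<in>\<sigma>. x \<in> A \<and> f A = B" if B: "B \<in> \<pi>" "x \<in> B" for x B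
  proof -
    obtain A where A: "A \<in> \<sigma>" "x \<in> A"
      using B part unfolding partition_on_def by blast
    then have "f A = B"
      using f[of A] B partition_on_unique_block[OF part(2)] by blast
    then show ?thesis using A by blast
  qed
  have "B \<in> f ` \<sigma>" if B: "B \<in> \<pi>" for B
  proof -
    obtain x where "x \<in> B" using B part by (fastforce simp: partition_on_def)
    then show ?thesis using cover[OF B] by blast
  qed
  then have im: "f ` \<sigma> = \<pi>" using f by blast
  then show "card \<pi> \<le> card \<sigma>" using fin card_image_le by metis
  show "\<sigma> = \<pi>" if "card \<pi> = card \<sigma>"
  proof -
    have inj: "inj_on f \<sigma>" using that im fin by (simp add: eq_card_imp_inj_on)
    have eq: "f A = A" if A: "A \<in> \<sigma>" for A
    proof
      show "f A \<subseteq> A"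
      proof
        fix x assume "x \<in> f A"
        then obtain A' where "A' \<in> \<sigma>" "x \<in> A'" "f A' = f A"
          using cover f(1)[OF A] by blast
        then show "x \<in> A" using inj_onD[OF inj] A by metis
      qed
    qed (use f A in auto)
    have "f ` \<sigma> = id ` \<sigma>" by (intro image_cong) (simp_all add: eq)
    then show ?thesis using im by simp
  qed
qed

section \<open>Merging blocks and saturated chains\<close>

text \<open>Paths inside either part survive, and paths between the parts run through the edge
  joining \<open>a\<close> and \<open>b\<close>.\<close>

lemma connected_graph_union:
  assumes A: "connected_graph A (induced_edges E A)" and B: "connected_graph B (induced_edges E B)"
    and "a \<in> A" "b \<in> B" "{a, b} \<in> E"
  shows "connected_graph (A \<union> B) (induced_edges E (A \<union> B))"
proof -
  let ?I = "\<lambda>S. {(x, y). {x, y} \<in> induced_edges E S}"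
  have "?I A \<subseteq> ?I (A \<union> B)" "?I B \<subseteq> ?I (A \<union> B)"
    by (auto simp: induced_edges_def)
  then have "(?I A)\<^sup>* \<subseteq> (?I (A \<union> B))\<^sup>*" "(?I B)\<^sup>* \<subseteq> (?I (A \<union> B))\<^sup>*"
    by - (erule rtrancl_mono)+
  then have *: "(u, v) \<in> (?I (A \<union> B))\<^sup>*" if "u \<in> A \<and> v \<in> A \<or> u \<in> B \<and> v \<in> B" for u v
    using A B that unfolding connected_graph_def by blast
  have ab: "(a, b) \<in> ?I (A \<union> B)" "(b, a) \<in> ?I (A \<union> B)"
    using assms by (auto simp: induced_edges_def insert_commute)
  have "(u, v) \<in> (?I (A \<union> B))\<^sup>*" if uv: "u \<in> A" "v \<in> B" for u v
    using *[of u a] *[of b v] ab uv assms(3,4) by (meson rtrancl_into_rtrancl rtrancl_trans)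
  moreover have "(u, v) \<in> (?I (A \<union> B))\<^sup>*" if uv: "u \<in> B" "v \<in> A" for u v
    using *[of u b] *[of a v] ab uv assms(3,4) by (meson rtrancl_into_rtrancl rtrancl_trans)
  ultimately show ?thesis
    using * assms(3) unfolding connected_graph_def by blast
qed

text \<open>Supplies the edge along which two blocks are merged: a path that ends outside
  \<open>A\<close> has a step across its boundary.\<close>

lemma rtrancl_leaves_set:
  assumes "(x, y) \<in> R\<^sup>*" "x \<in> A" "y \<notin> A"
  obtains a b where "(a, b) \<in> R" "a \<in> A" "b \<notin> A"
proof -
  have "y \<notin> A \<longrightarrow> (\<exists>a b. (a, b) \<in> R \<and> a \<in> A \<and> b \<notin> A)"
    using assms(1) by (induction rule: rtrancl_induct) (use assms(2) in auto)
  then show thesis using assms(3) that by blast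
qed

text \<open>Some block \<open>A\<close> of \<open>\<sigma>\<close> is strictly smaller than the
  block \<open>B\<close> of \<open>\<pi>\<close> around it. Since \<open>B\<close> is connected, an
  edge leaves \<open>A\<close> inside \<open>B\<close>, and \<open>A\<close> can be merged with the
  block \<open>A'\<close> at its other end without leaving \<open>B\<close>.\<close>

lemma bond_lattice_merge:
  assumes "finite V" and le: "(\<sigma>, \<pi>) \<in> bond_lattice V E" and "\<sigma> \<noteq> \<pi>"
  obtains \<sigma>' where "(\<sigma>, \<sigma>') \<in> bond_lattice V E" "(\<sigma>', \<pi>) \<in> bond_lattice V E"
    "card \<sigma> = Suc (card \<sigma>')"
proof -
  have part: "partition_on V \<sigma>" "partition_on V \<pi>"
    and bonds: "\<sigma> \<in> bond_partitions V E" "\<pi> \<in> bond_partitions V E" and ref: "refines V \<sigma> \<pi>"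
    using le by (auto simp: bond_lattice_def refines_def)
  have fin: "finite \<sigma>" using part assms by (auto intro: finite_elements)
  have below: "A \<subseteq> B" if "A \<in> \<sigma>" "B \<in> \<pi>" "x \<in> A" "x \<in> B" for A B x
    using that ref partition_on_unique_block[OF part(2)] unfolding refines_def by blast
  have block: "\<exists>A\<in>\<sigma>. x \<in> A" if "x \<in> B" "B \<in> \<pi>" for x B
    using that part unfolding partition_on_def by blast
  obtain A B where AB: "A \<in> \<sigma>" "B \<in> \<pi>" "A \<subset> B"
  proof -
    \<comment> \<open>If all blocks of \<open>\<sigma>\<close> were blocks of \<open>\<pi>\<close>,
      the two partitions would coincide, since \<open>\<sigma>\<close> already covers
      \<open>V\<close>.\<close>
    have "\<exists>A\<in>\<sigma>. A \<notin> \<pi>"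
    proof (rule ccontr)
      assume "\<not> ?thesis"
      then have sub: "\<sigma> \<subseteq> \<pi>" by blast
      have "B \<in> \<sigma>" if B: "B \<in> \<pi>" for B
      proof -
        obtain x where x: "x \<in> B" using B part by (fastforce simp: partition_on_def)
        then obtain A where "A \<in> \<sigma>" "x \<in> A" using block B by blast
        then show ?thesis using partition_on_unique_block[OF part(2), of A B x] sub B x by auto
      qed
      then show False using sub \<open>\<sigma> \<noteq> \<pi>\<close> by blast
    qed
    then show thesis using ref that unfolding refines_def by blast
  qed
  obtain x y where xy: "x \<in> A" "y \<in> B" "y \<notin> A"
    using AB part by (fastforce simp: partition_on_def)
  have conn: "connected_graph S (induced_edges E S)" if "S \<in> \<sigma> \<or> S \<in> \<pi>" for S
    using that bonds by (auto simp: bond_partitions_def)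
  then have "(x, y) \<in> {(x, y). {x, y} \<in> induced_edges E B}\<^sup>*"
    using xy AB unfolding connected_graph_def by blast
  then obtain a b where "(a, b) \<in> {(x, y). {x, y} \<in> induced_edges E B}" and a: "a \<in> A" and b: "b \<notin> A"
    by (rule rtrancl_leaves_set) (use xy in auto)
  then have edge: "{a, b} \<in> E" and bB: "b \<in> B" by (auto simp: induced_edges_def)
  obtain A' where A': "A' \<in> \<sigma>" "b \<in> A'" using block bB AB by blast
  then have A'B: "A' \<subseteq> B" using below AB bB by blast
  have ne: "A \<noteq> A'" using A' b by blast
  define \<sigma>' where "\<sigma>' = insert (A \<union> A') (\<sigma> - {A, A'})"
  have Un: "\<Union>(\<sigma> - {A, A'}) = V - (A \<union> A')"
  proof
    show "\<Union>(\<sigma> - {A, A'}) \<subseteq> V - (A \<union> A')"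
      using part(1) partition_on_unique_block[OF part(1)] AB A' unfolding partition_on_def by blast
    show "V - (A \<union> A') \<subseteq> \<Union>(\<sigma> - {A, A'})"
      using part(1) unfolding partition_on_def by blast
  qed
  have "partition_on (V - (A \<union> A')) (\<sigma> - {A, A'})"
    using part(1) Un by (auto simp: partition_on_def pairwise_def)
  moreover have "A \<union> A' \<subseteq> V" using AB A' part(1) unfolding partition_on_def by blast
  ultimately have part': "partition_on V \<sigma>'"
    unfolding \<sigma>'_def using xy Un by (subst partition_on_insert) (auto simp: disjnt_def)
  have "connected_graph (A \<union> A') (induced_edges E (A \<union> A'))"
    using conn AB A' a edge by (intro connected_graph_union[of _ _ _ a b]) auto
  then have bond': "\<sigma>' \<in> bond_partitions V E"
    using part' conn by (auto simp: bond_partitions_def \<sigma>'_def)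
  show thesis
  proof
    show "(\<sigma>, \<sigma>') \<in> bond_lattice V E"
      using bonds bond' by (intro bond_latticeI) (auto simp: \<sigma>'_def)
    show "(\<sigma>', \<pi>) \<in> bond_lattice V E"
      using bonds bond' ref AB A'B by (intro bond_latticeI) (auto simp: \<sigma>'_def refines_def)
    \<comment> \<open>The merged block has to be new for the number of blocks to drop by exactly
      one.\<close>
    have "A \<union> A' \<notin> \<sigma>"
    proof
      assume "A \<union> A' \<in> \<sigma>"
      then have "A \<union> A' = A"
        using partition_on_unique_block[OF part(1), of "A \<union> A'" A a] AB a by blast
      then show False using A' b by blast
    qed
    then have "card \<sigma>' = Suc (card (\<sigma> - {A, A'}))"
      using fin by (simp add: \<sigma>'_def)
    moreover have "card (\<sigma> - {A, A'}) = card \<sigma> - 2"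
      using fin AB A' ne by (subst card_Diff_subset) auto
    \<comment> \<open>Ensures that \<open>card \<sigma> - 2\<close> is not truncated.\<close>
    moreover have "card {A, A'} \<le> card \<sigma>"
      using fin AB A' by (intro card_mono) auto
    ultimately show "card \<sigma> = Suc (card \<sigma>')" using ne by simp
  qed
qed

text \<open>Successive merges lower the number of blocks by one until \<open>\<pi>\<close> is
  reached. The lower bound on the members of the chain is what allows a further element to be
  prepended; the upper bound places the chain in the interval that defines the rank.\<close>

lemma bond_lattice_chain_exists:
  assumes "finite V" "(\<sigma>, \<pi>) \<in> bond_lattice V E"
  shows "\<exists>C \<in> Chains (bond_lattice V E). (\<forall>\<tau>\<in>C. (\<sigma>, \<tau>) \<in> bond_lattice V E \<and> (\<tau>, \<pi>) \<in> bond_lattice V E) \<and>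
    finite C \<and> card C = Suc (card \<sigma> - card \<pi>)"
  using assms(2)
proof (induction "card \<sigma> - card \<pi>" arbitrary: \<sigma>)
  case 0
  then have "card \<pi> = card \<sigma>" using bond_lattice_card_le(1)[OF assms(1) 0(2)] by simp
  then have "\<sigma> = \<pi>" using bond_lattice_card_le(2)[OF assms(1) 0(2)] by simp
  then show ?case using 0 by (intro bexI[of _ "{\<pi>}"]) (auto simp: Chains_def)
next
  case (Suc d)
  let ?r = "bond_lattice V E"
  have po: "trans ?r" "antisym ?r"
    using Partial_order_bond_lattice[of V E] by (auto simp: partial_order_on_def preorder_on_def)
  have "\<sigma> \<noteq> \<pi>" using Suc(2) by auto
  then obtain \<sigma>' where \<sigma>': "(\<sigma>, \<sigma>') \<in> ?r" "(\<sigma>', \<pi>) \<in> ?r" "card \<sigma> = Suc (card \<sigma>')"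
    using bond_lattice_merge[OF assms(1) Suc(3)] by blast
  then have "d = card \<sigma>' - card \<pi>" using Suc(2) by simp
  then obtain C where C: "C \<in> Chains ?r" "\<forall>\<tau>\<in>C. (\<sigma>', \<tau>) \<in> ?r \<and> (\<tau>, \<pi>) \<in> ?r" "finite C"
    "card C = Suc (card \<sigma>' - card \<pi>)"
    using Suc(1) \<sigma>'(2) by blast
  have "\<sigma> \<notin> C"
  proof
    assume "\<sigma> \<in> C"
    then have "(\<sigma>', \<sigma>) \<in> ?r" using C(2) by blast
    then have "\<sigma> = \<sigma>'" using po(2) \<sigma>'(1) by (auto dest: antisymD)
    then show False using \<sigma>'(3) by simp
  qed
  moreover have up: "(\<sigma>, \<tau>) \<in> ?r" if "\<tau> \<in> C" for \<tau>
    using C(2) \<sigma>'(1) po(1) that by (blast dest: transD)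
  moreover have refl: "(\<sigma>, \<sigma>) \<in> ?r"
    using Suc(3) by (auto simp: bond_lattice_def refines_def)
  moreover have "insert \<sigma> C \<in> Chains ?r"
    using C(1) up refl by (auto simp: Chains_def)
  ultimately show ?case
    using C \<sigma>' Suc(2,3) by (intro bexI[of _ "insert \<sigma> C"]) auto
qed

section \<open>Rank, length and the characteristic polynomial at natural numbers\<close>

text \<open>On a chain the number of blocks is injective, and below \<open>\<pi>\<close> it lies
  between \<open>card \<pi>\<close> and \<open>card V\<close>. The chain of merges that starts from
  the singletons attains the resulting bound.\<close>

lemma poset_rank_bond_lattice:
  assumes "finite V" "\<pi> \<in> bond_partitions V E"
  shows "poset_rank (bond_lattice V E) \<pi> = card V - card \<pi>"
proof -
  let ?r = "bond_lattice V E" let ?R = "Restr ?r (under ?r \<pi>)" let ?z = "(\<lambda>v. {v}) ` V"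
  have card0: "card ?z = card V" by (simp add: card_image inj_on_def)
  have min: "(?z, \<tau>) \<in> ?r" if "\<tau> \<in> bond_partitions V E" for \<tau>
    using that by (rule singletons_le)
  have card_le: "card \<pi> \<le> card V"
    using bond_lattice_card_le(1)[OF assms(1) min[OF assms(2)]] by (simp only: card0)
  have finR: "finite ?R" using finite_bond_lattice[OF assms(1), of E] by simp
  have sub: "C \<subseteq> Field ?R" if "C \<in> Chains ?R" for C
    using that unfolding Chains_def by (blast intro: FieldI1)
  have fin: "finite (Chains ?R)"
  proof (rule finite_subset)
    show "Chains ?R \<subseteq> Pow (Field ?R)" using sub by blast
    show "finite (Pow (Field ?R))" using finite_Field[OF finR] by blast
  qed
  have "card C \<le> Suc (card V - card \<pi>)" if C: "C \<in> Chains ?R" for C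
  proof -
    have "inj_on card C"
    proof (rule inj_onI)
      fix \<sigma> \<tau> assume "\<sigma> \<in> C" "\<tau> \<in> C" and eq: "card \<sigma> = card \<tau>"
      then have "(\<sigma>, \<tau>) \<in> ?r \<or> (\<tau>, \<sigma>) \<in> ?r" using C unfolding Chains_def by blast
      then show "\<sigma> = \<tau>"
      proof
        assume "(\<sigma>, \<tau>) \<in> ?r"
        then show ?thesis using bond_lattice_card_le(2)[OF assms(1)] eq by simp
      next
        assume "(\<tau>, \<sigma>) \<in> ?r"
        then have "\<tau> = \<sigma>" using eq by (intro bond_lattice_card_le(2)[OF assms(1)])
        then show ?thesis by simp
      qed
    qed
    then have "card C = card (card ` C)" by (simp add: card_image)
    also have "\<dots> \<le> card {card \<pi>..card V}"
    proof (intro card_mono image_subsetI)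
      fix \<tau> assume "\<tau> \<in> C"
      then have "(\<tau>, \<pi>) \<in> ?r" using C unfolding Chains_def under_def by blast
      moreover from this have "(?z, \<tau>) \<in> ?r" by (intro min) (simp add: bond_lattice_def)
      ultimately have "card \<pi> \<le> card \<tau>" "card \<tau> \<le> card ?z"
        by (blast intro: bond_lattice_card_le(1)[OF assms(1)])+
      then show "card \<tau> \<in> {card \<pi>..card V}" by (simp add: card0)
    qed simp
    finally show ?thesis using card_le by simp
  qed
  moreover have "Suc (card V - card \<pi>) \<in> card ` Chains ?R"
  proof -
    obtain C where C: "C \<in> Chains ?r" "\<forall>\<tau>\<in>C. (\<tau>, \<pi>) \<in> ?r" "card C = Suc (card V - card \<pi>)"
      using bond_lattice_chain_exists[OF assms(1) min[OF assms(2)]] unfolding card0 by blast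
    then have "C \<in> Chains ?R" unfolding Chains_def under_def by blast
    then show ?thesis using C(3) by (metis image_eqI)
  qed
  ultimately have "Max (card ` Chains ?R) = Suc (card V - card \<pi>)"
    using fin by (intro Max_eqI) blast+
  then show ?thesis by (simp add: poset_rank_def poset_length_def)
qed

text \<open>Connectedness of the graph makes \<open>{V}\<close> the greatest element, so the length
  is the rank of \<open>{V}\<close>.\<close>

lemma poset_length_bond_lattice:
  assumes "finite V" "connected_graph V (induced_edges E V)"
  shows "poset_length (bond_lattice V E) = card V - 1"
proof -
  let ?r = "bond_lattice V E"
  have top: "{V} \<in> bond_partitions V E"
    using assms by (auto simp: bond_partitions_def connected_graph_def intro: partition_on_space)
  then have "(\<pi>, {V}) \<in> ?r" if "\<pi> \<in> bond_partitions V E" for \<pi>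
    using that by (intro bond_latticeI) (auto simp: bond_partitions_def partition_on_def)
  then have "Restr ?r (under ?r {V}) = ?r"
    by (auto simp: under_def bond_lattice_def)
  then show ?thesis
    using poset_rank_bond_lattice[OF assms(1) top] by (simp add: poset_rank_def)
qed

text \<open>The factor \<open>q\<close> raises the exponent \<open>card \<pi> - 1\<close> of the
  characteristic polynomial to the number of blocks, which is the exponent in
  \<open>card_proper_colourings\<close>.\<close>

lemma poly_char_poly_bond_lattice:
  assumes "finite V" "connected_graph V (induced_edges E V)" "\<And>x. {x} \<notin> E"
  shows "of_nat q * poly (poset_char_poly (bond_lattice V E)) (of_nat q) =
    of_nat (card {c \<in> V \<rightarrow>\<^sub>E {..<q}. proper_colouring V E c})"
proof -
  let ?r = "bond_lattice V E" let ?m = "mobius ?r (poset_min ?r)"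
  \<comment> \<open>No subtraction is truncated here, since \<open>card \<pi>\<close> lies between 1
    and \<open>card V\<close>; it is positive because \<open>V\<close> is nonempty.\<close>
  have exp: "Suc (poset_length ?r - poset_rank ?r \<pi>) = card \<pi>" if \<pi>: "\<pi> \<in> bond_partitions V E" for \<pi>
  proof -
    have part: "partition_on V \<pi>" using \<pi> by (simp add: bond_partitions_def)
    have "V \<noteq> {}" using assms by (simp add: connected_graph_def)
    then have "\<pi> \<noteq> {}" using part by (auto simp: partition_on_def)
    then have "card \<pi> > 0" using finite_elements[OF assms(1) part] by (simp add: card_gt_0_iff)
    moreover have "((\<lambda>v. {v}) ` V, \<pi>) \<in> ?r"
      using \<pi> by (rule singletons_le)
    then have "card \<pi> \<le> card ((\<lambda>v. {v}) ` V)" using bond_lattice_card_le(1)[OF assms(1)] by blast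
    then have "card \<pi> \<le> card V" by (simp add: card_image inj_on_def)
    ultimately show ?thesis
      using assms \<pi> by (simp add: poset_rank_bond_lattice poset_length_bond_lattice)
  qed
  have "of_nat q * poly (poset_char_poly ?r) (of_nat q) =
      (\<Sum>\<pi>\<in>bond_partitions V E. of_int (?m \<pi>) * of_nat q ^ Suc (poset_length ?r - poset_rank ?r \<pi>) :: rat)"
    by (simp add: poset_char_poly_def Field_bond_lattice poly_sum poly_monom sum_distrib_left mult_ac)
  also have "\<dots> = (\<Sum>\<pi>\<in>bond_partitions V E. of_int (?m \<pi> * int q ^ card \<pi>))"
    by (intro sum.cong refl) (simp only: exp, simp)
  also have "\<dots> = of_int (\<Sum>\<pi>\<in>bond_partitions V E. ?m \<pi> * int q ^ card \<pi>)"
    by (rule of_int_sum[symmetric])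
  also have "\<dots> = of_nat (card {c \<in> V \<rightarrow>\<^sub>E {..<q}. proper_colouring V E c})"
    unfolding card_proper_colourings[OF assms(1,3), symmetric] by (rule of_int_of_nat_eq)
  finally show ?thesis .
qed

section \<open>Colourings of \<open>\<Gamma>\<^sub>2\<^sub>n\<close>\<close>

lemma Gamma_edge_iff:
  "{x, y} \<in> Gamma_edges n \<longleftrightarrow>
    (\<exists>i j. 1 \<le> i \<and> i \<le> j \<and> j \<le> n \<and> (x = 2 * i - 1 \<and> y = 2 * j \<or> x = 2 * j \<and> y = 2 * i - 1))"
  unfolding Gamma_edges_def by (auto simp: doubleton_eq_iff)

lemma Gamma_no_loops: "{x} \<notin> Gamma_edges n"
proof
  assume "{x} \<in> Gamma_edges n"
  then obtain i j where "1 \<le> i" "x = 2 * i - 1" "x = 2 * j"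
    by (auto simp: Gamma_edges_def)
  then show False by presburger
qed

text \<open>Every odd vertex is adjacent to \<open>2 * n\<close>, and every even vertex is joined to
  \<open>2 * n\<close> through vertex 1.\<close>

lemma Gamma_connected:
  assumes "n \<ge> 1"
  shows "connected_graph (Gamma_verts n) (induced_edges (Gamma_edges n) (Gamma_verts n))"
proof -
  let ?R = "{(x, y). {x, y} \<in> induced_edges (Gamma_edges n) (Gamma_verts n)}"
  have sym: "sym (?R\<^sup>*)" by (intro sym_rtrancl) (auto simp: sym_def insert_commute)
  have edge: "(2 * i - 1, 2 * j) \<in> ?R" if "1 \<le> i" "i \<le> j" "j \<le> n" for i j
    using that by (auto simp: induced_edges_def Gamma_verts_def Gamma_edge_iff)
  have to: "(v, 2 * n) \<in> ?R\<^sup>*" if v: "v \<in> Gamma_verts n" for v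
  proof (cases "odd v")
    case True
    then obtain k where k: "v = 2 * k + 1" by (auto elim: oddE)
    then have "Suc k \<le> n" using v by (auto simp: Gamma_verts_def)
    then show ?thesis using edge[of "Suc k" n] k by auto
  next
    case False
    then obtain k where k: "v = 2 * k" by (auto elim: evenE)
    then have "1 \<le> k" "k \<le> n" using v by (auto simp: Gamma_verts_def)
    then have "(2 * 1 - 1, v) \<in> ?R" "(2 * 1 - 1, 2 * n) \<in> ?R"
      using edge[of 1 k] edge[of 1 n] k assms by auto
    then show ?thesis using sym by (blast intro: rtrancl_trans dest: symD)
  qed
  then have "(u, v) \<in> ?R\<^sup>*" if "u \<in> Gamma_verts n" "v \<in> Gamma_verts n" for u v
    using that sym by (blast intro: rtrancl_trans dest: symD)
  moreover have "Gamma_verts n \<noteq> {}" using assms by (auto simp: Gamma_verts_def)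
  ultimately show ?thesis unfolding connected_graph_def by blast
qed

lemma proper_colouring_Gamma:
  "proper_colouring (Gamma_verts n) (Gamma_edges n) c \<longleftrightarrow>
    (\<forall>j\<in>{1..n}. \<forall>i\<in>{1..j}. c (2 * i - 1) \<noteq> c (2 * j))"
proof
  assume p: "proper_colouring (Gamma_verts n) (Gamma_edges n) c"
  show "\<forall>j\<in>{1..n}. \<forall>i\<in>{1..j}. c (2 * i - 1) \<noteq> c (2 * j)"
  proof (intro ballI)
    fix j i assume *: "j \<in> {1..n}" "i \<in> {1..j}"
    then have "{2 * i - 1, 2 * j} \<in> Gamma_edges n"
      "2 * i - 1 \<in> Gamma_verts n" "2 * j \<in> Gamma_verts n"
      by (auto simp: Gamma_edge_iff Gamma_verts_def)
    then show "c (2 * i - 1) \<noteq> c (2 * j)" using p unfolding proper_colouring_def by blast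
  qed
next
  assume p: "\<forall>j\<in>{1..n}. \<forall>i\<in>{1..j}. c (2 * i - 1) \<noteq> c (2 * j)"
  show "proper_colouring (Gamma_verts n) (Gamma_edges n) c"
    unfolding proper_colouring_def Gamma_edge_iff
  proof (intro ballI impI)
    fix x y
    assume "\<exists>i j. 1 \<le> i \<and> i \<le> j \<and> j \<le> n \<and>
      (x = 2 * i - 1 \<and> y = 2 * j \<or> x = 2 * j \<and> y = 2 * i - 1)"
    then obtain i j where ij: "1 \<le> i" "i \<le> j" "j \<le> n"
      and xy: "x = 2 * i - 1 \<and> y = 2 * j \<or> x = 2 * j \<and> y = 2 * i - 1" by blast
    have "c (2 * i - 1) \<noteq> c (2 * j)" using p ij by auto
    then show "c x \<noteq> c y" using xy by metis
  qed
qed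

section \<open>Colourings sorted by the number of colours on odd vertices\<close>

definition odd_colours :: "nat \<Rightarrow> (nat \<Rightarrow> nat) \<Rightarrow> nat set" where
  "odd_colours n c = (\<lambda>i. c (2 * i - 1)) ` {1..n}"

text \<open>The parameter \<open>m\<close> is recorded because the number of ways to colour the next
  two vertices depends on the colouring only through it.\<close>

definition Gamma_colourings :: "nat \<Rightarrow> nat \<Rightarrow> nat \<Rightarrow> (nat \<Rightarrow> nat) set" where
  "Gamma_colourings q n m = {c \<in> Gamma_verts n \<rightarrow>\<^sub>E {..<q}.
     proper_colouring (Gamma_verts n) (Gamma_edges n) c \<and> card (odd_colours n c) = m}"

lemma finite_Gamma_colourings: "finite (Gamma_colourings q n m)"
  by (rule finite_subset[of _ "Gamma_verts n \<rightarrow>\<^sub>E {..<q}"])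
    (auto simp: Gamma_colourings_def Gamma_verts_def intro: finite_PiE)

lemma card_Gamma_colourings_0: "card (Gamma_colourings q 0 m) = (if m = 0 then 1 else 0)"
  by (auto simp: Gamma_colourings_def Gamma_verts_def odd_colours_def proper_colouring_def)

lemma card_Gamma_colourings_Suc_0: "card (Gamma_colourings q (Suc n) 0) = 0"
  by (auto simp: Gamma_colourings_def odd_colours_def card_eq_0_iff)

lemma Gamma_verts_Suc: "Gamma_verts (Suc n) = insert (2 * n + 2) (insert (2 * n + 1) (Gamma_verts n))"
  by (auto simp: Gamma_verts_def)

lemma odd_colours_Suc: "odd_colours (Suc n) c = insert (c (2 * n + 1)) (odd_colours n c)"
  by (simp add: odd_colours_def atLeastAtMostSuc_conv)

lemma odd_colours_upd: "odd_colours n (c(2 * n + 1 := a, 2 * n + 2 := b)) = odd_colours n c"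
  unfolding odd_colours_def by (intro image_cong) auto

lemma odd_colours_subset: "c \<in> Gamma_verts n \<rightarrow>\<^sub>E {..<q} \<Longrightarrow> odd_colours n c \<subseteq> {..<q}"
  by (fastforce simp: odd_colours_def Gamma_verts_def PiE_iff)

text \<open>Vertex \<open>2 * n + 1\<close> has no earlier neighbour, and the neighbours of
  \<open>2 * n + 2\<close> are exactly the odd vertices before it.\<close>

lemma proper_colouring_Gamma_Suc:
  "proper_colouring (Gamma_verts (Suc n)) (Gamma_edges (Suc n)) c \<longleftrightarrow>
    proper_colouring (Gamma_verts n) (Gamma_edges n) c \<and> c (2 * n + 2) \<notin> odd_colours (Suc n) c"
  unfolding proper_colouring_Gamma odd_colours_def
  by (simp add: atLeastAtMostSuc_conv) (auto simp: image_iff)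

lemma proper_colouring_Gamma_upd:
  "proper_colouring (Gamma_verts n) (Gamma_edges n) (c(2 * n + 1 := a, 2 * n + 2 := b)) \<longleftrightarrow>
    proper_colouring (Gamma_verts n) (Gamma_edges n) c"
  unfolding proper_colouring_Gamma
proof (intro ball_cong refl)
  fix j i assume "j \<in> {1..n}" "i \<in> {1..j}"
  then have "2 * i - 1 \<noteq> 2 * n + 1" "2 * i - 1 \<noteq> 2 * n + 2" "2 * j \<noteq> 2 * n + 1" "2 * j \<noteq> 2 * n + 2"
    by auto
  then show "((c(2 * n + 1 := a, 2 * n + 2 := b)) (2 * i - 1) \<noteq> (c(2 * n + 1 := a, 2 * n + 2 := b)) (2 * j)) =
    (c (2 * i - 1) \<noteq> c (2 * j))" by simp
qed


text \<open>Cutting off the last two vertices turns a colouring into a triple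
  \<open>(c, a, b)\<close>, where \<open>a\<close> and \<open>b\<close> are their colours. Either
  \<open>a\<close> is new on the odd vertices, or it is one of \<open>Suc m\<close> colours already
  there; in both cases \<open>b\<close> has to avoid \<open>Suc m\<close> colours.\<close>

lemma card_Gamma_colourings_Suc_Suc:
  "card (Gamma_colourings q (Suc n) (Suc m)) =
    (q - m) * (q - Suc m) * card (Gamma_colourings q n m) +
    Suc m * (q - Suc m) * card (Gamma_colourings q n (Suc m))"
proof -
  let ?new = "SIGMA c:Gamma_colourings q n m. SIGMA a:{..<q} - odd_colours n c.
    {..<q} - insert a (odd_colours n c)"
  let ?old = "SIGMA c:Gamma_colourings q n (Suc m). SIGMA a:odd_colours n c. {..<q} - odd_colours n c"
  let ?f = "\<lambda>(c, a, b). c(2 * n + 1 := a, 2 * n + 2 := b)"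
  have fin_odd: "finite (odd_colours k c)" for k c by (simp add: odd_colours_def)
  have bij: "bij_betw ?f (?new \<union> ?old) (Gamma_colourings q (Suc n) (Suc m))"
  proof (rule bij_betwI[where g = "\<lambda>c. (restrict c (Gamma_verts n), c (2 * n + 1), c (2 * n + 2))"])
    have out: "2 * n + 1 \<notin> Gamma_verts n" "2 * n + 2 \<notin> Gamma_verts n"
      by (auto simp: Gamma_verts_def)
    show "?f \<in> ?new \<union> ?old \<rightarrow> Gamma_colourings q (Suc n) (Suc m)"
    proof
      fix x assume x: "x \<in> ?new \<union> ?old"
      obtain c a b where xeq: "x = (c, a, b)" by (cases x)
      let ?c = "c(2 * n + 1 := a, 2 * n + 2 := b)"
      have c: "c \<in> Gamma_verts n \<rightarrow>\<^sub>E {..<q}" "proper_colouring (Gamma_verts n) (Gamma_edges n) c"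
        using x xeq by (auto simp: Gamma_colourings_def)
      have ab: "a < q" "b < q" "b \<notin> insert a (odd_colours n c)"
        "card (insert a (odd_colours n c)) = Suc m"
        using x xeq odd_colours_subset[OF c(1)] fin_odd[of n c]
        by (auto simp: Gamma_colourings_def insert_absorb)
      have odd: "odd_colours (Suc n) ?c = insert a (odd_colours n c)"
        by (simp only: odd_colours_Suc odd_colours_upd) simp
      have "?c \<in> Gamma_verts (Suc n) \<rightarrow>\<^sub>E {..<q}"
        using c(1) ab by (auto simp: Gamma_verts_Suc PiE_iff extensional_def)
      moreover have "proper_colouring (Gamma_verts (Suc n)) (Gamma_edges (Suc n)) ?c"
        unfolding proper_colouring_Gamma_Suc proper_colouring_Gamma_upd odd using c ab by simp
      ultimately show "?f x \<in> Gamma_colourings q (Suc n) (Suc m)"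
        using odd ab xeq by (simp add: Gamma_colourings_def)
    qed
    show "(\<lambda>c. (restrict c (Gamma_verts n), c (2 * n + 1), c (2 * n + 2)))
        \<in> Gamma_colourings q (Suc n) (Suc m) \<rightarrow> ?new \<union> ?old"
    proof
      fix c assume c: "c \<in> Gamma_colourings q (Suc n) (Suc m)"
      let ?c = "restrict c (Gamma_verts n)"
      have PiE: "c \<in> Gamma_verts (Suc n) \<rightarrow>\<^sub>E {..<q}"
        and proper: "proper_colouring (Gamma_verts n) (Gamma_edges n) c"
        and b: "c (2 * n + 2) \<notin> insert (c (2 * n + 1)) (odd_colours n c)"
        and card: "card (insert (c (2 * n + 1)) (odd_colours n c)) = Suc m"
        using c by (auto simp: Gamma_colourings_def proper_colouring_Gamma_Suc odd_colours_Suc)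
      have ab: "c (2 * n + 1) < q" "c (2 * n + 2) < q"
        using PiE by (auto simp: Gamma_verts_Suc PiE_iff)
      have odd: "odd_colours n ?c = odd_colours n c"
        unfolding odd_colours_def by (intro image_cong) (auto simp: Gamma_verts_def)
      have "proper_colouring (Gamma_verts n) (Gamma_edges n) ?c"
        using proper by (simp add: proper_colouring_def)
      moreover have "?c \<in> Gamma_verts n \<rightarrow>\<^sub>E {..<q}"
        using PiE by (auto simp: Gamma_verts_Suc PiE_iff)
      \<comment> \<open>The number of odd colours is left open at this point: the case split that
        follows gives \<open>Suc m\<close> if the colour of \<open>2 * n + 1\<close> occurred
        before, and \<open>m\<close> otherwise.\<close>
      ultimately have "?c \<in> Gamma_colourings q n (card (odd_colours n c))"
        using odd by (simp add: Gamma_colourings_def)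
      then show "(?c, c (2 * n + 1), c (2 * n + 2)) \<in> ?new \<union> ?old"
        using ab b card odd fin_odd[of n c]
        by (cases "c (2 * n + 1) \<in> odd_colours n c") (auto simp: insert_absorb)
    qed
    show "(restrict (?f x) (Gamma_verts n), ?f x (2 * n + 1), ?f x (2 * n + 2)) = x"
      if x: "x \<in> ?new \<union> ?old" for x
    proof -
      obtain c a b where xeq: "x = (c, a, b)" by (cases x)
      have c: "c \<in> Gamma_verts n \<rightarrow>\<^sub>E {..<q}" using x xeq by (auto simp: Gamma_colourings_def)
      have "restrict (c(2 * n + 1 := a, 2 * n + 2 := b)) (Gamma_verts n) = c"
      proof
        fix v show "restrict (c(2 * n + 1 := a, 2 * n + 2 := b)) (Gamma_verts n) v = c v"
          using out c by (cases "v \<in> Gamma_verts n") (auto simp: PiE_iff extensional_def)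
      qed
      then show ?thesis using xeq by simp
    qed
    show "?f (restrict c (Gamma_verts n), c (2 * n + 1), c (2 * n + 2)) = c"
      if c: "c \<in> Gamma_colourings q (Suc n) (Suc m)" for c
    proof
      fix v show "?f (restrict c (Gamma_verts n), c (2 * n + 1), c (2 * n + 2)) v = c v"
        using c by (auto simp: Gamma_colourings_def Gamma_verts_Suc PiE_iff extensional_def)
    qed
  qed
  have fin: "finite ?new" "finite ?old"
    using finite_Gamma_colourings fin_odd by (auto intro!: finite_SigmaI)
  have disj: "?new \<inter> ?old = {}" by auto
  have "card ?new = (\<Sum>c\<in>Gamma_colourings q n m. (q - m) * (q - Suc m))"
  proof (subst card_SigmaI, goal_cases)
    case 3
    show ?case
    proof (rule sum.cong[OF refl])
      fix c assume c: "c \<in> Gamma_colourings q n m"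
      then have sub: "odd_colours n c \<subseteq> {..<q}" and card: "card (odd_colours n c) = m"
        by (auto simp: Gamma_colourings_def dest: odd_colours_subset)
      have "card (SIGMA a:{..<q} - odd_colours n c. {..<q} - insert a (odd_colours n c)) =
          (\<Sum>a\<in>{..<q} - odd_colours n c. card ({..<q} - insert a (odd_colours n c)))"
        by (intro card_SigmaI) auto
      also have "\<dots> = (\<Sum>a\<in>{..<q} - odd_colours n c. q - Suc m)"
      proof (rule sum.cong[OF refl])
        fix a assume "a \<in> {..<q} - odd_colours n c"
        then show "card ({..<q} - insert a (odd_colours n c)) = q - Suc m"
          using sub card fin_odd[of n c] by (subst card_Diff_subset) auto
      qed
      also have "\<dots> = (q - m) * (q - Suc m)"
        using sub card fin_odd[of n c] by (simp add: card_Diff_subset)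
      finally show "card (SIGMA a:{..<q} - odd_colours n c. {..<q} - insert a (odd_colours n c)) =
        (q - m) * (q - Suc m)" .
    qed
  qed (use finite_Gamma_colourings in auto)
  moreover have "card ?old = (\<Sum>c\<in>Gamma_colourings q n (Suc m). Suc m * (q - Suc m))"
  proof (subst card_SigmaI, goal_cases)
    case 3
    show ?case
    proof (rule sum.cong[OF refl])
      fix c assume c: "c \<in> Gamma_colourings q n (Suc m)"
      then have sub: "odd_colours n c \<subseteq> {..<q}" and card: "card (odd_colours n c) = Suc m"
        by (auto simp: Gamma_colourings_def dest: odd_colours_subset)
      then show "card (SIGMA a:odd_colours n c. {..<q} - odd_colours n c) = Suc m * (q - Suc m)"
        using fin_odd[of n c] by (simp add: card_Diff_subset card_cartesian_product)
    qed
  qed (use finite_Gamma_colourings fin_odd in auto)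
  moreover have "card (Gamma_colourings q (Suc n) (Suc m)) = card ?new + card ?old"
    using bij_betw_same_card[OF bij] card_Un_disjoint[OF fin disj] by simp
  ultimately show ?thesis by simp
qed

text \<open>There are \<open>n\<close> odd vertices, so at most \<open>n\<close> colours occur on
  them.\<close>

lemma card_proper_colourings_Gamma:
  "card {c \<in> Gamma_verts n \<rightarrow>\<^sub>E {..<q}. proper_colouring (Gamma_verts n) (Gamma_edges n) c} =
    (\<Sum>m\<le>n. card (Gamma_colourings q n m))"
proof -
  have "{c \<in> Gamma_verts n \<rightarrow>\<^sub>E {..<q}. proper_colouring (Gamma_verts n) (Gamma_edges n) c} =
      (\<Union>m\<le>n. Gamma_colourings q n m)"
  proof -
    have "card (odd_colours n c) \<le> n" for c
      using card_image_le[of "{1..n}" "\<lambda>i. c (2 * i - 1)"] by (simp add: odd_colours_def)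
    then show ?thesis by (auto simp: Gamma_colourings_def)
  qed
  also have "card \<dots> = (\<Sum>m\<le>n. card (Gamma_colourings q n m))"
    by (intro card_UN_disjoint) (simp_all add: finite_Gamma_colourings, auto simp: Gamma_colourings_def)
  finally show ?thesis .
qed

section \<open>The generating function\<close>

lemma falling_fact_Suc: "falling_fact a (Suc n) = falling_fact a n * (a - of_nat n)"
  by (simp add: falling_fact_def)

text \<open>For \<open>a = tvar\<close> this splits off the factor \<open>t\<close> by which the
  chromatic and the characteristic polynomial differ.\<close>

lemma falling_fact_shift: "falling_fact a (Suc n) = a * falling_fact (a - 1) n"
  unfolding falling_fact_def by (subst prod.lessThan_Suc_shift) (simp add: algebra_simps)

section \<open>Coefficients of the reciprocal products\<close>

text \<open>Generating function of the complete homogeneous symmetric polynomials in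
  \<open>x 1\<close> to \<open>x m\<close>.\<close>

definition geom_product :: "(nat \<Rightarrow> 'a::comm_ring_1) \<Rightarrow> nat \<Rightarrow> 'a fps" where
  "geom_product x m = fps_recip (\<Prod>k=1..m. 1 - fps_const (x k) * fps_X)"

lemma geom_product_denominator:
  "(\<Prod>k=1..m. 1 - fps_const (x k) * fps_X) * geom_product x m = (1 :: 'a::comm_ring_1 fps)"
proof -
  have "(\<Prod>k=1..m. 1 - fps_const (x k) * fps_X) $ 0 = (1 :: 'a)"
    by (induction m) (simp_all add: fps_mult_nth_0)
  then show ?thesis unfolding geom_product_def by (rule fps_recip)
qed

text \<open>The two denominators differ by one linear factor. On coefficients this sorts the
  monomials by whether the last variable occurs.\<close>

lemma geom_product_Suc:
  "geom_product x (Suc m) = geom_product x m + fps_const (x (Suc m)) * fps_X * geom_product x (Suc m)"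
proof -
  let ?D = "\<lambda>m. \<Prod>k=1..m. 1 - fps_const (x k) * fps_X" and ?a = "fps_const (x (Suc m)) * fps_X"
  \<comment> \<open>In place of a division, 1 is inserted as denominator times reciprocal for
    \<open>Suc m\<close>.\<close>
  have "geom_product x m = geom_product x m * (?D (Suc m) * geom_product x (Suc m))"
    by (simp only: geom_product_denominator mult_1_right)
  also have "?D (Suc m) = ?D m * (1 - ?a)" by simp
  also have "geom_product x m * (?D m * (1 - ?a) * geom_product x (Suc m)) =
      (?D m * geom_product x m) * ((1 - ?a) * geom_product x (Suc m))"
    by (simp only: mult_ac)
  also have "\<dots> = (1 - ?a) * geom_product x (Suc m)"
    by (simp only: geom_product_denominator mult_1_left)
  finally show ?thesis by (simp add: algebra_simps)
qed

lemma geom_product_0: "geom_product x 0 = 1"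
  using geom_product_denominator[of x 0] by simp

lemma geom_product_nth_0: "geom_product x m $ 0 = 1"
proof -
  have "(\<Prod>k=1..m. 1 - fps_const (x k) * fps_X) $ 0 = (1 :: 'a)"
    by (induction m) (simp_all add: fps_mult_nth_0)
  then show ?thesis
    using arg_cong[OF geom_product_denominator[of x m], of "\<lambda>f. f $ 0"] by (simp add: fps_mult_nth_0)
qed

lemma geom_product_nth_Suc:
  "geom_product x (Suc m) $ Suc r = geom_product x m $ Suc r + x (Suc m) * geom_product x (Suc m) $ r"
  by (subst geom_product_Suc) (simp add: mult.assoc)

section \<open>Polynomials that interpolate the colouring counts\<close>

definition weight :: "nat \<Rightarrow> rat poly" where
  "weight k = of_nat k * (tvar - of_nat k)"

text \<open>For \<open>m \<ge> 1\<close> this is \<open>t\<close> times the coefficient of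
  \<open>u ^ n\<close> in the \<open>m\<close>-th summand; in this form \<open>m = 0\<close> also
  fits and starts the recurrence with 1 at \<open>n = 0\<close>. The guard is there because
  \<open>n - m\<close> truncates to 0, where the coefficient is 1.\<close>

definition Gamma_poly :: "nat \<Rightarrow> nat \<Rightarrow> rat poly" where
  "Gamma_poly n m = falling_fact tvar m * falling_fact (tvar - 1) m *
     (if m \<le> n then geom_product weight m $ (n - m) else 0)"

lemma Gamma_poly_0: "Gamma_poly 0 m = (if m = 0 then 1 else 0)"
  by (simp add: Gamma_poly_def falling_fact_def geom_product_0)

lemma Gamma_poly_Suc_0: "Gamma_poly (Suc n) 0 = 0"
  by (simp add: Gamma_poly_def geom_product_0)

text \<open>The second term is the recurrence of the reciprocal products with last variable
  \<open>weight (Suc m)\<close>; the factors in the first come from extending both falling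
  factorials by one step.\<close>

lemma Gamma_poly_Suc_Suc:
  "Gamma_poly (Suc n) (Suc m) =
    (tvar - of_nat m) * (tvar - of_nat (Suc m)) * Gamma_poly n m +
    of_nat (Suc m) * (tvar - of_nat (Suc m)) * Gamma_poly n (Suc m)"
proof -
  let ?h = "geom_product weight"
  have step: "falling_fact tvar (Suc m) * falling_fact (tvar - 1) (Suc m) =
      (tvar - of_nat m) * (tvar - of_nat (Suc m)) * (falling_fact tvar m * falling_fact (tvar - 1) m)"
    by (simp add: falling_fact_Suc algebra_simps)
  \<comment> \<open>For \<open>n < m\<close> all terms vanish. At \<open>n = m\<close> only constant
    coefficients 1 occur, and \<open>Gamma_poly n (Suc m)\<close> is 0.\<close>
  consider "n < m" | "n = m" | "Suc m \<le> n" by linarith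
  then show ?thesis
  proof cases
    case 3
    then obtain r where r: "n = Suc m + r" using le_Suc_ex by blast
    have "?h (Suc m) $ (Suc n - Suc m) = ?h m $ (n - m) + weight (Suc m) * ?h (Suc m) $ (n - Suc m)"
      using r geom_product_nth_Suc[of weight m r] by simp
    then have "Gamma_poly (Suc n) (Suc m) = falling_fact tvar (Suc m) * falling_fact (tvar - 1) (Suc m) *
       (?h m $ (n - m)) + weight (Suc m) * (falling_fact tvar (Suc m) * falling_fact (tvar - 1) (Suc m) *
         ?h (Suc m) $ (n - Suc m))"
      using 3 by (simp add: Gamma_poly_def algebra_simps)
    also have "weight (Suc m) * (falling_fact tvar (Suc m) * falling_fact (tvar - 1) (Suc m) *
         ?h (Suc m) $ (n - Suc m)) = of_nat (Suc m) * (tvar - of_nat (Suc m)) * Gamma_poly n (Suc m)"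
      using 3 by (simp only: Gamma_poly_def weight_def if_True)
    also have "falling_fact tvar (Suc m) * falling_fact (tvar - 1) (Suc m) * (?h m $ (n - m)) =
        (tvar - of_nat m) * (tvar - of_nat (Suc m)) * Gamma_poly n m"
      using 3 by (simp only: step Gamma_poly_def mult.assoc) simp
    finally show ?thesis .
  next
    case 2
    have "Gamma_poly (Suc m) (Suc m) = falling_fact tvar (Suc m) * falling_fact (tvar - 1) (Suc m)"
      by (simp add: Gamma_poly_def geom_product_nth_0)
    moreover have "Gamma_poly m m = falling_fact tvar m * falling_fact (tvar - 1) m"
      by (simp add: Gamma_poly_def geom_product_nth_0)
    moreover have "Gamma_poly m (Suc m) = 0" by (simp add: Gamma_poly_def)
    ultimately show ?thesis using 2 by (simp only: step mult_zero_right add_0_right)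
  qed (simp add: Gamma_poly_def)
qed

lemma poly_of_nat_rat: "poly (of_nat m :: rat poly) x = of_nat m"
  by (simp add: of_nat_poly)

text \<open>The factor with index \<open>q\<close> vanishes.\<close>

lemma poly_falling_fact_eq_0:
  assumes "q < m" shows "poly (falling_fact tvar m) (of_nat q) = 0"
  unfolding falling_fact_def poly_prod
  using assms by (intro prod_zero bexI[of _ q]) (auto simp: poly_of_nat_rat)

text \<open>Both sides have the same initial values and the same recurrence, except that the counts
  use truncated subtraction.\<close>

lemma poly_Gamma_poly: "poly (Gamma_poly n m) (of_nat q) = of_nat (card (Gamma_colourings q n m))"
proof (induction n arbitrary: m)
  case 0
  then show ?case by (simp add: Gamma_poly_0 card_Gamma_colourings_0)
next
  case (Suc n)
  show ?case
  proof (cases m)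
    case 0
    then show ?thesis by (simp add: Gamma_poly_Suc_0 card_Gamma_colourings_Suc_0)
  next
    case (Suc k)
    have lhs: "poly (Gamma_poly (Suc n) (Suc k)) (of_nat q) =
      (of_nat q - of_nat k) * (of_nat q - of_nat (Suc k)) * of_nat (card (Gamma_colourings q n k)) +
      of_nat (Suc k) * (of_nat q - of_nat (Suc k)) * of_nat (card (Gamma_colourings q n (Suc k)))"
      by (simp only: Gamma_poly_Suc_Suc poly_add poly_mult poly_diff poly_of_nat_rat Suc.IH) simp
    show ?thesis
    proof (cases "Suc k \<le> q")
      case True
      then show ?thesis
        by (simp only: Suc lhs card_Gamma_colourings_Suc_Suc of_nat_add of_nat_mult of_nat_diff
            Suc_leD)
    next
      \<comment> \<open>With fewer than \<open>Suc k\<close> colours the truncated differences no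
        longer agree with the rational ones, but both sides are 0.\<close>
      case False
      then have "poly (Gamma_poly (Suc n) (Suc k)) (of_nat q) = 0"
        by (simp only: Gamma_poly_def poly_mult) (simp add: poly_falling_fact_eq_0)
      moreover have "card (Gamma_colourings q (Suc n) (Suc k)) = 0"
        using False by (simp add: card_Gamma_colourings_Suc_Suc)
      ultimately show ?thesis using Suc by simp
    qed
  qed
qed

text \<open>A nonzero difference would have only finitely many roots. This is how counts for each
  number of colours determine a polynomial.\<close>

lemma poly_eqI_nat:
  fixes p r :: "rat poly"
  assumes "\<And>q::nat. poly p (of_nat q) = poly r (of_nat q)"
  shows "p = r"
proof (rule ccontr)
  assume "p \<noteq> r"
  then have "finite {x. poly (p - r) x = 0}" by (intro poly_roots_finite) simp
  moreover have "range (of_nat :: nat \<Rightarrow> rat) \<subseteq> {x. poly (p - r) x = 0}" using assms by auto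
  ultimately have "finite (range (of_nat :: nat \<Rightarrow> rat))" by (rule rev_finite_subset)
  moreover have "inj (of_nat :: nat \<Rightarrow> rat)" by (rule inj_of_nat)
  ultimately show False using finite_imageD by blast
qed

section \<open>Comparison of the characteristic polynomials with the series\<close>

text \<open>At every natural number \<open>q\<close> both sides count the proper colourings with
  \<open>q\<close> colours. Connectedness requires a nonempty graph, hence
  \<open>n \<ge> 1\<close>.\<close>

lemma char_poly_Gamma:
  assumes "n \<ge> 1"
  shows "tvar * poset_char_poly (bond_lattice (Gamma_verts n) (Gamma_edges n)) = (\<Sum>m\<le>n. Gamma_poly n m)"
proof (rule poly_eqI_nat)
  fix q :: nat
  have "finite (Gamma_verts n)" by (simp add: Gamma_verts_def)
  from poly_char_poly_bond_lattice[OF this Gamma_connected[OF assms] Gamma_no_loops, of q]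
  show "poly (tvar * poset_char_poly (bond_lattice (Gamma_verts n) (Gamma_edges n))) (of_nat q) =
      poly (\<Sum>m\<le>n. Gamma_poly n m) (of_nat q)"
    by (simp add: poly_sum poly_Gamma_poly card_proper_colourings_Gamma)
qed

definition gf_term :: "nat \<Rightarrow> rat poly fps" where
  "gf_term n = fps_const (falling_fact (tvar - 1) n * falling_fact (tvar - 1) (n - 1)) * fps_X ^ n
     * geom_product weight n"

text \<open>The factor \<open>t\<close> completes \<open>falling_fact (tvar - 1) (m - 1)\<close> to
  \<open>falling_fact tvar m\<close>; at \<open>m = 0\<close> the truncated \<open>m - 1\<close>
  would break this.\<close>

lemma gf_term_nth:
  assumes "m \<ge> 1"
  shows "tvar * gf_term m $ n = Gamma_poly n m"
proof -
  obtain k where k: "m = Suc k" using assms by (cases m) auto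
  have "gf_term m $ n = falling_fact (tvar - 1) m * falling_fact (tvar - 1) (m - 1) *
      (if m \<le> n then geom_product weight m $ (n - m) else 0)"
    unfolding gf_term_def by (simp add: mult.assoc fps_X_power_mult_nth not_le)
  moreover have "falling_fact tvar m = tvar * falling_fact (tvar - 1) (m - 1)"
    using k by (simp only: falling_fact_shift) simp
  ultimately show ?thesis by (simp only: Gamma_poly_def mult_ac)
qed

lemma char_poly_Gamma_eq_sum:
  assumes "n \<ge> 1"
  shows "poset_char_poly (bond_lattice (Gamma_verts n) (Gamma_edges n)) = (\<Sum>m=1..n. gf_term m $ n)"
proof -
  obtain n' where n': "n = Suc n'" using assms by (cases n) auto
  have "tvar * poset_char_poly (bond_lattice (Gamma_verts n) (Gamma_edges n)) = (\<Sum>m\<in>{0..n}. Gamma_poly n m)"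
    using char_poly_Gamma[OF assms] by (simp only: atMost_atLeast0)
  \<comment> \<open>The summand \<open>m = 0\<close> vanishes for \<open>n \<ge> 1\<close>, as some
    colour occurs on an odd vertex.\<close>
  also have "\<dots> = (\<Sum>m=1..n. Gamma_poly n m)"
    using n' by (subst sum.atLeast_Suc_atMost) (simp_all add: Gamma_poly_Suc_0)
  also have "\<dots> = tvar * (\<Sum>m=1..n. gf_term m $ n)"
    unfolding sum_distrib_left by (intro sum.cong refl) (simp only: gf_term_nth atLeastAtMost_iff)
  \<comment> \<open>The factor \<open>t\<close> cancels because polynomials over the rationals form
    an integral domain.\<close>
  finally show ?thesis by (simp only: mult_cancel_left) simp
qed

text \<open>Convergence of formal power series is settled coefficient by coefficient:
  \<open>gf_term n\<close> is a multiple of \<open>fps_X ^ n\<close>, so every coefficient of the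
  partial sums is eventually constant.\<close>

theorem theorem5p5:
  shows "(\<lambda>m. let n = Suc m in
            fps_const (falling_fact (tvar - 1) n * falling_fact (tvar - 1) (n - 1)) * fps_X ^ n
              * fps_recip (\<Prod>k=1..n. 1 - fps_const (of_nat k * (tvar - of_nat k)) * fps_X))
         sums Abs_fps (\<lambda>n. if n \<ge> 1
                           then poset_char_poly (bond_lattice (Gamma_verts n) (Gamma_edges n))
                           else 0)"
proof -
  have term_eq: "(\<lambda>m. let n = Suc m in
            fps_const (falling_fact (tvar - 1) n * falling_fact (tvar - 1) (n - 1)) * fps_X ^ n
              * fps_recip (\<Prod>k=1..n. 1 - fps_const (of_nat k * (tvar - of_nat k)) * fps_X)) =
    (\<lambda>m. gf_term (Suc m))"
    by (simp only: Let_def gf_term_def geom_product_def weight_def)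
  have zero: "gf_term m $ n = 0" if "n < m" for m n
    using that by (simp add: gf_term_def mult.assoc fps_X_power_mult_nth)
  show ?thesis
    unfolding term_eq sums_def
  proof (rule tendsto_fpsI)
    fix n
    have "(\<Sum>m<N. gf_term (Suc m)) $ n = (\<Sum>m=1..n. gf_term m $ n)" if "N \<ge> n" for N
    proof -
      have "(\<Sum>m<N. gf_term (Suc m)) $ n = (\<Sum>m<N. gf_term (Suc m) $ n)"
        by (rule fps_sum_nth)
      \<comment> \<open>The shift turns the indices \<open>{..<N}\<close> into
        \<open>{1..N}\<close>, of which those above \<open>n\<close> contribute nothing to this
        coefficient.\<close>
      also have "\<dots> = (\<Sum>m\<in>Suc ` {..<N}. gf_term m $ n)"
        by (simp add: sum.reindex)
      also have "\<dots> = (\<Sum>m=1..n. gf_term m $ n)"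
        by (rule sum.mono_neutral_right) (use that in \<open>auto intro!: zero simp: image_Suc_lessThan\<close>)
      finally show ?thesis .
    qed
    moreover have "(\<Sum>m=1..n. gf_term m $ n) =
        Abs_fps (\<lambda>n. if n \<ge> 1 then poset_char_poly (bond_lattice (Gamma_verts n) (Gamma_edges n)) else 0) $ n"
      by (cases "n \<ge> 1") (simp_all add: char_poly_Gamma_eq_sum)
    ultimately show "\<forall>\<^sub>F N in sequentially. (\<Sum>m<N. gf_term (Suc m)) $ n =
        Abs_fps (\<lambda>n. if n \<ge> 1 then poset_char_poly (bond_lattice (Gamma_verts n) (Gamma_edges n)) else 0) $ n"
      by (auto intro: eventually_sequentiallyI[of n])
  qed
qed

end
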